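(* Let $m\in[-1,1]$, let $r,s$ be natural numbers, let $i\ge 2$ be an integer, and let $w$ be a natural number such that $T_w(T_s^{i-1}(m))=T_s^i(m)$. Then for every integer $\ell\ge 1$, $$T_s^{i+\ell}(m)=T_w^{\ell}(T_s^i(m))\qquad\text{and}\qquad T_s^{i+\ell}(T_r(m))=T_w^{\ell}(T_s^i(T_r(m))).$$ (Hence an adversary who knows only the authentication messages of the two consecutive sessions $i-1$ and $i$, and such a $w$, can produce the valid authentication pair of every later session $i+\ell$, without knowing $m$ or $T_r(m)$.)
   Context: For $n\in\mathbb{N}$ (with $0\in\mathbb{N}$), the Chebyshev polynomial $T_n:[-1,1]\to[-1,1]$ is defined recursively by $T_0(x)=1$, $T_1(x)=x$, $T_n(x)=2x\,T_{n-1}(x)-T_{n-2}(x)$ for $n\ge 2$; equivalently $T_n(x)=\cos(n\arccos(x))$. $T_s^i$ denotes the map $T_s$ composed with itself $i$ times, so that $T_s^i=T_{s^i}$. In the authentication scheme considered, the server holds a secret integer $r$ and gives $T_r(m)$ to the user; the user holds a secret integer $s$ and in the $i$-th session ($i=1,2,\dots$) sends $T_s^i(m)$ and $auth=T_s^i(T_r(m))$; the server accepts if $auth=T_r(T_s^i(m))$. *)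

theory Defs
  imports Complex_Main
begin

fun chebyshev_T :: "nat \<Rightarrow> real \<Rightarrow> real" where
  "chebyshev_T 0 x = 1"
| "chebyshev_T (Suc 0) x = x"
| "chebyshev_T (Suc (Suc n)) x = 2 * x * chebyshev_T (Suc n) x - chebyshev_T n x"

lemma chebyshev_T_cos: "chebyshev_T n (cos t) = cos (real n * t)"
proof (induction n "cos t" rule: chebyshev_T.induct)
  case (3 n)
  have "cos (real (Suc (Suc n)) * t) = cos (real (Suc n) * t + t)"
    by (simp add: algebra_simps)
  moreover have "cos (real n * t) = cos (real (Suc n) * t - t)"
    by (simp add: algebra_simps)
  ultimately show ?case
    using 3 by (simp add: cos_add cos_diff)
qed auto

lemma chebyshev_T_arccos:
  assumes "x \<in> {-1..1}"
  shows "chebyshev_T n x = cos (real n * arccos x)"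
  using assms chebyshev_T_cos[of n "arccos x"] by simp

lemma chebyshev_T_range:
  assumes "x \<in> {-1..1}"
  shows "chebyshev_T n x \<in> {-1..1}"
  using assms by (simp add: chebyshev_T_arccos)

text \<open>The pair sent by the user with secret \<open>s\<close> in session \<open>i\<close>. The user's
  second input is \<open>y = T r m\<close>, issued by the server.\<close>

definition auth_message :: "real \<Rightarrow> real \<Rightarrow> nat \<Rightarrow> nat \<Rightarrow> real \<times> real" where
  "auth_message m y s i = ((chebyshev_T s ^^ i) m, (chebyshev_T s ^^ i) y)"

definition server_accepts :: "nat \<Rightarrow> real \<times> real \<Rightarrow> bool" where
  "server_accepts r p \<longleftrightarrow> snd p = chebyshev_T r (fst p)"

text \<open>The adversary's computation. Its only inputs are \<open>w\<close>, the number \<open>l\<close> of sessions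
  to skip, and one intercepted pair; in particular neither \<open>m\<close> nor \<open>T r m\<close>. The pair of the
  preceding session enters only through the equation that \<open>w\<close> has to satisfy.\<close>

definition forge :: "nat \<Rightarrow> nat \<Rightarrow> real \<times> real \<Rightarrow> real \<times> real" where
  "forge w l p = ((chebyshev_T w ^^ l) (fst p), (chebyshev_T w ^^ l) (snd p))"

end

(* Chebyshev polynomials commute on [-1,1]. So if T_w agrees with T_s at one point of the
   T_s-orbit of m, it agrees with T_s at all later points of that orbit, and at their images
   under T_r, which are the points of the T_s-orbit of T_r(m). *)
theory Submission
  imports Defs
begin

text \<open>With \<open>x = cos t\<close>, both sides equal \<open>cos (a * b * t)\<close>.\<close>

lemma chebyshev_T_commute:
  assumes "x \<in> {-1..1}"
  shows "chebyshev_T a (chebyshev_T b x) = chebyshev_T b (chebyshev_T a x)"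
proof -
  obtain t where "x = cos t"
    using assms by (metis atLeastAtMost_iff cos_arccos)
  then show ?thesis
    by (simp add: chebyshev_T_cos mult.left_commute)
qed

lemma chebyshev_T_funpow_range:
  assumes "x \<in> {-1..1}"
  shows "(chebyshev_T s ^^ k) x \<in> {-1..1}"
proof (induction k)
  case 0
  show ?case using assms by simp
next
  case (Suc k)
  show ?case using chebyshev_T_range[OF Suc] by simp
qed

lemma chebyshev_T_funpow_commute:
  assumes "x \<in> {-1..1}"
  shows "(chebyshev_T s ^^ k) (chebyshev_T r x) = chebyshev_T r ((chebyshev_T s ^^ k) x)"
proof (induction k)
  case (Suc k)
  then show ?case
    using chebyshev_T_commute[OF chebyshev_T_funpow_range[OF assms]] by simp
qed simp

text \<open>Agreement at the single point \<open>x\<close> suffices: in the induction step the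
  outermost \<open>T_w\<close> commutes past the \<open>l\<close> copies of \<open>T_s\<close> and
  reaches \<open>x\<close>, where it can be replaced by \<open>T_s\<close>.\<close>

lemma chebyshev_T_funpow_eq:
  assumes "x \<in> {-1..1}" and "chebyshev_T w x = chebyshev_T s x"
  shows "(chebyshev_T w ^^ l) x = (chebyshev_T s ^^ l) x"
proof (induction l)
  case (Suc l)
  have "(chebyshev_T w ^^ Suc l) x = chebyshev_T w ((chebyshev_T s ^^ l) x)"
    using Suc by simp
  also have "\<dots> = (chebyshev_T s ^^ l) (chebyshev_T s x)"
    using assms by (simp flip: chebyshev_T_funpow_commute)
  finally show ?case
    by (simp add: funpow_swap1)
qed simp

theorem mainTheorem6:
  fixes m :: real and r s i w :: nat
  assumes "m \<in> {-1..1}"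
    and "i \<ge> 2"
    and "chebyshev_T w ((chebyshev_T s ^^ (i - 1)) m) = (chebyshev_T s ^^ i) m"
  shows "\<forall>l::nat. l \<ge> 1 \<longrightarrow>
    (chebyshev_T s ^^ (i + l)) m = (chebyshev_T w ^^ l) ((chebyshev_T s ^^ i) m) \<and>
    (chebyshev_T s ^^ (i + l)) (chebyshev_T r m)
      = (chebyshev_T w ^^ l) ((chebyshev_T s ^^ i) (chebyshev_T r m)) \<and>
    forge w l (auth_message m (chebyshev_T r m) s i)
      = auth_message m (chebyshev_T r m) s (i + l) \<and>
    server_accepts r (forge w l (auth_message m (chebyshev_T r m) s i))"
proof -
  define x where "x = (chebyshev_T s ^^ (i - 1)) m"
  have x: "x \<in> {-1..1}"
    unfolding x_def using assms(1) by (rule chebyshev_T_funpow_range)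
  \<comment> \<open>Since \<open>i\<close> is positive, the truncated \<open>i - 1\<close> is a true
    predecessor.\<close>
  have step: "(chebyshev_T s ^^ i) m = chebyshev_T s x"
    using assms(2) unfolding x_def by (cases i) simp_all
  have y: "(chebyshev_T s ^^ i) m \<in> {-1..1}"
    using assms(1) by (rule chebyshev_T_funpow_range)
  have "chebyshev_T w x = chebyshev_T s x"
    using assms(3) step by (simp add: x_def)
  \<comment> \<open>The agreement moves one session forward, from \<open>x\<close> to
    \<open>T_s x\<close>: \<open>T_w (T_s x) = T_s (T_w x) = T_s (T_s x)\<close>.\<close>
  then have eq: "chebyshev_T w ((chebyshev_T s ^^ i) m) = chebyshev_T s ((chebyshev_T s ^^ i) m)"
    unfolding step using chebyshev_T_commute[OF x, of w s] by simp
  have first: "(chebyshev_T s ^^ (i + l)) m = (chebyshev_T w ^^ l) ((chebyshev_T s ^^ i) m)" for l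
    using chebyshev_T_funpow_eq[OF y eq] by (simp add: funpow_add add.commute[of i])
  have second: "(chebyshev_T s ^^ (i + l)) (chebyshev_T r m)
      = (chebyshev_T w ^^ l) ((chebyshev_T s ^^ i) (chebyshev_T r m))" for l
    \<comment> \<open>Pulling \<open>T_r\<close> out of all iterates turns both sides into
      \<open>T_r\<close> of the two sides of \<open>first\<close>.\<close>
    using assms(1) y by (simp add: chebyshev_T_funpow_commute first del: atLeastAtMost_iff)
  \<comment> \<open>Genuine pairs pass the check in every session, so a forged pair passes once it
    equals a genuine one.\<close>
  have "server_accepts r (auth_message m (chebyshev_T r m) s k)" for k
    using assms(1) by (simp add: server_accepts_def auth_message_def chebyshev_T_funpow_commute)
  moreover have "forge w l (auth_message m (chebyshev_T r m) s i)
      = auth_message m (chebyshev_T r m) s (i + l)" for l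
    by (simp add: forge_def auth_message_def first second)
  ultimately show ?thesis
    using first second by simp
qed

end
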